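(* Let $n\ge1$ and let $\mathscr{H}(\lambda)=\sum_{k=1}^M\lambda_kH_k$ be an $n$-spin Hamiltonian model on $(\mathbb{C}^2)^{\otimes n}$, and let $\mathcal{S}(\mathscr{H})$ be the set of Pauli operators appearing in the model. If $|\mathcal{S}(\mathscr{H})|<2n$, then there is a subspace $V$ with $\{0\}\ne V\ne(\mathbb{C}^2)^{\otimes n}$ and $\mathscr{H}(\lambda)V\subseteq V$ for all $\lambda\in\mathbb{R}^M$.
   Context: Let $\sigma_0=I_2$ and let $\sigma_1,\sigma_2,\sigma_3$ be the Pauli matrices. Put $\mathcal{P}_n=\{\sigma_{j_1}\otimes\cdots\otimes\sigma_{j_n} : 0\le j_1,\dots,j_n\le3\}$ and $\mathcal{P}_n^*=\mathcal{P}_n\setminus\{I_{2^n}\}$. An $n$-spin Hamiltonian model is a function $\mathscr{H}(\lambda)=\sum_{k=1}^M\lambda_kH_k$ of $\lambda\in\mathbb{R}^M$ ($M\ge 1$) where each $H_k$ is a fixed self-adjoint operator on $(\mathbb{C}^2)^{\otimes n}$ that is a linear combination of elements of $\mathcal{P}_n^*$. The set of Pauli operators appearing in the model is $\mathcal{S}(\mathscr{H})=\{\sigma\in\mathcal{P}_n^* : \sigma \text{ has non-zero coefficient in the expansion of some } H_k \text{ in } \mathcal{P}_n^*\}$, i.e. those $\sigma$ with $\mathrm{tr}(\sigma^\dagger H_k)\ne0$ for some $k$. *)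

theory Defs
  imports "Jordan_Normal_Form.Schur_Decomposition" "Jordan_Normal_Form.VS_Connect"
begin

text \<open>
  \<open>(\<complex>\<^sup>2)\<^sup>\<otimes>\<^sup>n\<close> is identified with \<open>carrier_vec (2 ^ n)\<close> through the lexicographically ordered
  product basis; under this identification the tensor product of operators is the Kronecker
  product of matrices.
\<close>

definition kron :: "complex mat \<Rightarrow> complex mat \<Rightarrow> complex mat" where
  "kron A B = mat (dim_row A * dim_row B) (dim_col A * dim_col B)
     (\<lambda>(i, j). A $$ (i div dim_row B, j div dim_col B) * B $$ (i mod dim_row B, j mod dim_col B))"

text \<open>Only the indices \<open>0, 1, 2, 3\<close> are meaningful; larger ones never occur below.\<close>

definition pauli :: "nat \<Rightarrow> complex mat" where
  "pauli j =
     (if j = 0 then 1\<^sub>m 2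
      else if j = 1 then mat_of_rows_list 2 [[0, 1], [1, 0]]
      else if j = 2 then mat_of_rows_list 2 [[0, - \<i>], [\<i>, 0]]
      else mat_of_rows_list 2 [[1, 0], [0, -1]])"

fun pauli_tensor :: "nat list \<Rightarrow> complex mat" where
  "pauli_tensor [] = 1\<^sub>m 1"
| "pauli_tensor (j # js) = kron (pauli j) (pauli_tensor js)"

definition pauli_ops :: "nat \<Rightarrow> complex mat set" where
  "pauli_ops n = {pauli_tensor js |js. length js = n \<and> set js \<subseteq> {0..3}}"

definition pauli_ops_star :: "nat \<Rightarrow> complex mat set" where
  "pauli_ops_star n = pauli_ops n - {1\<^sub>m (2 ^ n)}"

abbreviation op_space :: "nat \<Rightarrow> (complex, complex mat) module" where
  "op_space n \<equiv> module_mat TYPE(complex) (2 ^ n) (2 ^ n)"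

definition pauli_expansion :: "nat \<Rightarrow> complex mat \<Rightarrow> (complex mat \<Rightarrow> complex) \<Rightarrow> bool" where
  "pauli_expansion n A c \<longleftrightarrow> A = (\<Oplus>\<^bsub>op_space n\<^esub> \<sigma> \<in> pauli_ops_star n. c \<sigma> \<cdot>\<^sub>m \<sigma>)"

text \<open>
  The operators \<open>H\<^sub>1, \<dots>, H\<^sub>M\<close> are \<open>H 0, \<dots>, H (M - 1)\<close>; the values \<open>H k\<close> with \<open>k \<ge> M\<close> play no role.
\<close>

definition spin_hamiltonian_model :: "nat \<Rightarrow> nat \<Rightarrow> (nat \<Rightarrow> complex mat) \<Rightarrow> bool" where
  "spin_hamiltonian_model n M H \<longleftrightarrow>
     M \<ge> 1 \<and>
     (\<forall>k<M. H k \<in> carrier_mat (2 ^ n) (2 ^ n) \<and> mat_adjoint (H k) = H k \<and>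
            (\<exists>c. pauli_expansion n (H k) c))"

definition hamiltonian :: "nat \<Rightarrow> nat \<Rightarrow> (nat \<Rightarrow> complex mat) \<Rightarrow> real vec \<Rightarrow> complex mat" where
  "hamiltonian n M H l = (\<Oplus>\<^bsub>op_space n\<^esub> k \<in> {..<M}. complex_of_real (l $ k) \<cdot>\<^sub>m H k)"

text \<open>
  The coefficients of an expansion in \<open>pauli_ops_star n\<close> are unique, so the existential quantifier
  over \<open>c\<close> refers to the expansion of \<open>H k\<close>; see \<open>appearing_paulis_trace\<close> at the end.
\<close>

definition appearing_paulis :: "nat \<Rightarrow> nat \<Rightarrow> (nat \<Rightarrow> complex mat) \<Rightarrow> complex mat set" where
  "appearing_paulis n M H =
     {\<sigma> \<in> pauli_ops_star n. \<exists>k<M. \<exists>c. pauli_expansion n (H k) c \<and> c \<sigma> \<noteq> 0}"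


subsection \<open>Uniqueness of Pauli expansions\<close>

text \<open>Hilbert-Schmidt inner product \<open>tr (A\<^sup>\<dagger> B)\<close>; see \<open>hs_inner_eq_trace\<close>.\<close>

definition hs_inner :: "complex mat \<Rightarrow> complex mat \<Rightarrow> complex" where
  "hs_inner A B = (\<Sum>i<dim_row A. \<Sum>j<dim_col A. cnj (A $$ (i, j)) * B $$ (i, j))"

lemma pauli_carrier: "pauli j \<in> carrier_mat 2 2"
  by (auto simp: pauli_def mat_of_rows_list_def)

lemma pauli_tensor_carrier: "pauli_tensor js \<in> carrier_mat (2 ^ length js) (2 ^ length js)"
  by (induction js) (auto simp: kron_def carrier_matD[OF pauli_carrier])

lemma hs_inner_pauli:
  assumes "j \<le> 3" "k \<le> 3"
  shows "hs_inner (pauli j) (pauli k) = (if j = k then 2 else 0)"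
proof -
  have sum2: "(\<Sum>i<2. f i) = f 0 + f 1" for f :: "nat \<Rightarrow> complex"
    by (simp add: numeral_2_eq_2)
  have "j \<in> {0, 1, 2, 3}" "k \<in> {0, 1, 2, 3}" using assms by auto
  then show ?thesis
    unfolding hs_inner_def carrier_matD[OF pauli_carrier] sum2
    by (elim insertE emptyE) (simp_all add: pauli_def mat_of_rows_list_def)
qed

lemma sum_div_mod:
  fixes f :: "nat \<Rightarrow> nat \<Rightarrow> complex"
  assumes "m > 0"
  shows "(\<Sum>i<r * m. f (i div m) (i mod m)) = (\<Sum>a<r. \<Sum>b<m. f a b)"
proof -
  have less: "a * m + b < r * m" if "a < r" "b < m" for a b
  proof -
    have "a * m + b < Suc a * m" using that by simp
    also have "\<dots> \<le> r * m" using that by (intro mult_le_mono1) simp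
    finally show ?thesis .
  qed
  have "(\<Sum>i<r * m. f (i div m) (i mod m)) = (\<Sum>(a, b)\<in>{..<r} \<times> {..<m}. f a b)"
    using assms less
    by (intro sum.reindex_bij_witness[of _ "\<lambda>(a, b). a * m + b" "\<lambda>i. (i div m, i mod m)"])
       (auto simp: less_mult_imp_div_less)
  then show ?thesis by (simp add: sum.cartesian_product)
qed

lemma hs_inner_kron:
  assumes A: "A \<in> carrier_mat 2 2" "A' \<in> carrier_mat 2 2"
    and B: "B \<in> carrier_mat m m" "B' \<in> carrier_mat m m" and m: "m > 0"
  shows "hs_inner (kron A B) (kron A' B') = hs_inner A A' * hs_inner B B'"
proof -
  define g where "g a b c d =
    cnj (A $$ (a, c)) * A' $$ (a, c) * (cnj (B $$ (b, d)) * B' $$ (b, d))" for a b c d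
  have "hs_inner (kron A B) (kron A' B') =
      (\<Sum>i<2 * m. \<Sum>j<2 * m. g (i div m) (i mod m) (j div m) (j mod m))"
    using A B by (auto simp: hs_inner_def kron_def g_def intro!: sum.cong)
  also have "\<dots> = (\<Sum>a<2. \<Sum>b<m. \<Sum>c<2. \<Sum>d<m. g a b c d)"
    by (simp add: sum_div_mod[OF m] sum_div_mod[OF m, where f = "\<lambda>a b. \<Sum>c<2. \<Sum>d<m. g a b c d"])
  also have "\<dots> = (\<Sum>a<2. \<Sum>c<2. \<Sum>b<m. \<Sum>d<m. g a b c d)"
    by (intro sum.cong refl sum.swap)
  also have "\<dots> = (\<Sum>a<2. \<Sum>c<2. cnj (A $$ (a, c)) * A' $$ (a, c) * hs_inner B B')"
    using B by (simp add: hs_inner_def g_def sum_distrib_left)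
  also have "\<dots> = hs_inner A A' * hs_inner B B'"
    using A by (simp add: hs_inner_def sum_distrib_right)
  finally show ?thesis .
qed

lemma hs_inner_pauli_tensor:
  assumes "length js = length ks" "set js \<subseteq> {0..3}" "set ks \<subseteq> {0..3}"
  shows "hs_inner (pauli_tensor js) (pauli_tensor ks) = (if js = ks then 2 ^ length js else 0)"
  using assms
proof (induction js ks rule: list_induct2)
  case Nil
  then show ?case by (simp add: hs_inner_def)
next
  case (Cons j js k ks)
  have "hs_inner (pauli_tensor (j # js)) (pauli_tensor (k # ks)) =
      hs_inner (pauli j) (pauli k) * hs_inner (pauli_tensor js) (pauli_tensor ks)"
    unfolding pauli_tensor.simps
  proof (rule hs_inner_kron[where m = "2 ^ length js"])
    show "pauli_tensor ks \<in> carrier_mat (2 ^ length js) (2 ^ length js)"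
      using pauli_tensor_carrier[of ks] Cons.hyps by simp
  qed (simp_all add: pauli_carrier pauli_tensor_carrier)
  moreover have "hs_inner (pauli j) (pauli k) = (if j = k then 2 else 0)"
    using Cons.prems by (intro hs_inner_pauli) simp_all
  ultimately show ?case using Cons.IH Cons.prems by simp
qed

lemma hs_inner_pauli_ops:
  assumes "\<sigma> \<in> pauli_ops n" "\<tau> \<in> pauli_ops n"
  shows "hs_inner \<sigma> \<tau> = (if \<sigma> = \<tau> then 2 ^ n else 0)"
proof -
  obtain js where js: "\<sigma> = pauli_tensor js" "length js = n" "set js \<subseteq> {0..3}"
    using assms(1) unfolding pauli_ops_def by blast
  obtain ks where ks: "\<tau> = pauli_tensor ks" "length ks = n" "set ks \<subseteq> {0..3}"
    using assms(2) unfolding pauli_ops_def by blast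
  have "hs_inner \<sigma> \<sigma> = 2 ^ n" "hs_inner \<sigma> \<tau> = (if js = ks then 2 ^ n else 0)"
    using hs_inner_pauli_tensor[of js js] hs_inner_pauli_tensor[of js ks] js ks by metis+
  then show ?thesis using js(1) ks(1) by (cases "js = ks") auto
qed

lemma pauli_ops_carrier: "pauli_ops n \<subseteq> carrier_mat (2 ^ n) (2 ^ n)"
  using pauli_tensor_carrier by (auto simp: pauli_ops_def)

lemma finite_pauli_ops: "finite (pauli_ops n)"
proof -
  have "pauli_ops n = pauli_tensor ` {js. set js \<subseteq> {0..3} \<and> length js = n}"
    by (auto simp: pauli_ops_def)
  then show ?thesis by (simp add: finite_lists_length_eq)
qed

lemma card_pauli_ops: "card (pauli_ops n) = 4 ^ n"
proof -
  have eq: "pauli_ops n = pauli_tensor ` {js. set js \<subseteq> {0..3} \<and> length js = n}"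
    by (auto simp: pauli_ops_def)
  have "inj_on pauli_tensor {js. set js \<subseteq> {0..3} \<and> length js = n}"
  proof (rule inj_onI)
    fix js ks
    assume js: "js \<in> {js. set js \<subseteq> {0..3} \<and> length js = n}"
      and ks: "ks \<in> {js. set js \<subseteq> {0..3} \<and> length js = n}"
      and e: "pauli_tensor js = pauli_tensor ks"
    have "hs_inner (pauli_tensor js) (pauli_tensor ks) \<noteq> 0"
      using js e hs_inner_pauli_tensor[of js js] by simp
    then show "js = ks" using js ks hs_inner_pauli_tensor[of js ks] by (auto split: if_splits)
  qed
  then show ?thesis by (simp add: eq card_image card_lists_length_eq)
qed

lemma finsum_op_space:
  assumes "finite X" "\<And>x. x \<in> X \<Longrightarrow> f x \<in> carrier_mat (2 ^ n) (2 ^ n)"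
  shows "finsum (op_space n) f X \<in> carrier_mat (2 ^ n) (2 ^ n) \<and>
    (\<forall>i<2 ^ n. \<forall>j<2 ^ n. finsum (op_space n) f X $$ (i, j) = (\<Sum>x\<in>X. f x $$ (i, j)))"
  using assms
proof (induction X rule: finite_induct)
  interpret abelian_group "op_space n" by (rule abelian_group_mat)
  case empty
  show ?case by (simp add: module_mat_simps)
next
  interpret abelian_group "op_space n" by (rule abelian_group_mat)
  case (insert x X)
  have "finsum (op_space n) f (insert x X) = f x + finsum (op_space n) f X"
    using insert finsum_insert[of X x f] by (auto simp: module_mat_simps)
  then show ?case using insert by auto
qed

lemma hs_inner_expansion:
  assumes c: "pauli_expansion n A c" and \<sigma>: "\<sigma> \<in> pauli_ops_star n"
  shows "hs_inner \<sigma> A = 2 ^ n * c \<sigma>"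
proof -
  let ?P = "pauli_ops_star n" and ?N = "2 ^ n :: nat"
  have P: "finite ?P" "?P \<subseteq> pauli_ops n" "?P \<subseteq> carrier_mat ?N ?N"
    using finite_pauli_ops pauli_ops_carrier by (auto simp: pauli_ops_star_def)
  have carr: "\<tau> \<in> carrier_mat ?N ?N" if "\<tau> \<in> ?P" for \<tau> using that P by auto
  have d\<sigma>: "dim_row \<sigma> = ?N" "dim_col \<sigma> = ?N" using carr[OF \<sigma>] by auto
  have entry: "A $$ (i, j) = (\<Sum>\<tau>\<in>?P. c \<tau> * \<tau> $$ (i, j))" if "i < ?N" "j < ?N" for i j
  proof -
    have "A $$ (i, j) = (\<Sum>\<tau>\<in>?P. (c \<tau> \<cdot>\<^sub>m \<tau>) $$ (i, j))"
      using c finsum_op_space[of ?P "\<lambda>\<tau>. c \<tau> \<cdot>\<^sub>m \<tau>" n] carr P(1) that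
      by (auto simp: pauli_expansion_def)
    also have "\<dots> = (\<Sum>\<tau>\<in>?P. c \<tau> * \<tau> $$ (i, j))"
      using carr that by (intro sum.cong refl) (metis carrier_matD index_smult_mat(1))
    finally show ?thesis .
  qed
  have "hs_inner \<sigma> A = (\<Sum>i<?N. \<Sum>j<?N. \<Sum>\<tau>\<in>?P. c \<tau> * (cnj (\<sigma> $$ (i, j)) * \<tau> $$ (i, j)))"
    by (auto simp: hs_inner_def d\<sigma> entry sum_distrib_left mult_ac intro!: sum.cong)
  also have "\<dots> = (\<Sum>i<?N. \<Sum>\<tau>\<in>?P. \<Sum>j<?N. c \<tau> * (cnj (\<sigma> $$ (i, j)) * \<tau> $$ (i, j)))"
    by (intro sum.cong refl sum.swap)
  also have "\<dots> = (\<Sum>\<tau>\<in>?P. \<Sum>i<?N. \<Sum>j<?N. c \<tau> * (cnj (\<sigma> $$ (i, j)) * \<tau> $$ (i, j)))"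
    by (rule sum.swap)
  also have "\<dots> = (\<Sum>\<tau>\<in>?P. c \<tau> * hs_inner \<sigma> \<tau>)"
    by (simp add: hs_inner_def d\<sigma> sum_distrib_left)
  also have "\<dots> = (\<Sum>\<tau>\<in>?P. if \<tau> = \<sigma> then 2 ^ n * c \<sigma> else 0)"
    using P(2) \<sigma> by (intro sum.cong refl) (auto simp: hs_inner_pauli_ops[of _ n] subset_iff)
  also have "\<dots> = 2 ^ n * c \<sigma>" using P(1) \<sigma> by simp
  finally show ?thesis .
qed

lemma pauli_expansion_unique:
  assumes "pauli_expansion n A c" "pauli_expansion n A d" "\<sigma> \<in> pauli_ops_star n"
  shows "c \<sigma> = d \<sigma>"
  using hs_inner_expansion[OF assms(1,3)] hs_inner_expansion[OF assms(2,3)] by simp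

lemma hs_inner_eq_trace:
  assumes A: "A \<in> carrier_mat m m" and B: "B \<in> carrier_mat m m"
  shows "hs_inner A B = (\<Sum>i<m. (mat_adjoint A * B) $$ (i, i))"
proof -
  have "(mat_adjoint A * B) $$ (i, i) = (\<Sum>j<m. cnj (A $$ (j, i)) * B $$ (j, i))" if "i < m" for i
  proof -
    have "(mat_adjoint A * B) $$ (i, i) = row (mat_adjoint A) i \<bullet> col B i"
      using that A B by (simp add: mat_adjoint_def)
    also have "row (mat_adjoint A) i = conjugate (col A i)"
      using that A by (auto simp: mat_adjoint_def)
    finally show ?thesis
      using that A B by (simp add: scalar_prod_def atLeast0LessThan)
  qed
  then have "(\<Sum>i<m. (mat_adjoint A * B) $$ (i, i)) =
      (\<Sum>i<m. \<Sum>j<m. cnj (A $$ (j, i)) * B $$ (j, i))" by simp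
  also have "\<dots> = (\<Sum>j<m. \<Sum>i<m. cnj (A $$ (j, i)) * B $$ (j, i))" by (rule sum.swap)
  finally show ?thesis using A by (simp add: hs_inner_def)
qed

lemma appearing_paulis_trace:
  assumes "spin_hamiltonian_model n M H"
  shows "appearing_paulis n M H =
    {\<sigma> \<in> pauli_ops_star n. \<exists>k<M. (\<Sum>i<2 ^ n. (mat_adjoint \<sigma> * H k) $$ (i, i)) \<noteq> 0}"
proof -
  have "(\<exists>c. pauli_expansion n (H k) c \<and> c \<sigma> \<noteq> 0) \<longleftrightarrow>
      (\<Sum>i<2 ^ n. (mat_adjoint \<sigma> * H k) $$ (i, i)) \<noteq> 0"
    if k: "k < M" and \<sigma>: "\<sigma> \<in> pauli_ops_star n" for k \<sigma>
  proof -
    have "\<sigma> \<in> carrier_mat (2 ^ n) (2 ^ n)"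
      using \<sigma> pauli_ops_carrier by (auto simp: pauli_ops_star_def)
    moreover obtain c where "pauli_expansion n (H k) c" and "H k \<in> carrier_mat (2 ^ n) (2 ^ n)"
      using assms k unfolding spin_hamiltonian_model_def by blast
    ultimately show ?thesis
      using hs_inner_expansion[OF _ \<sigma>] hs_inner_eq_trace[of \<sigma> "2 ^ n" "H k"]
      by (metis mult_eq_0_iff power_not_zero zero_neq_numeral)
  qed
  then show ?thesis unfolding appearing_paulis_def by blast
qed

end

theory Submission
  imports Defs "Jordan_Normal_Form.Spectral_Radius"
begin

text \<open>
  There are \<open>4\<^sup>n\<close> Pauli operators but at most \<open>2 ^ |S| < 4\<^sup>n\<close> subsets of the set \<open>S\<close> of appearing
  ones, so two distinct Pauli operators \<open>\<sigma>\<close>, \<open>\<tau>\<close> commute with the same elements of \<open>S\<close>. As Pauli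
  operators commute or anticommute, \<open>\<sigma> \<tau>\<close> commutes with all of \<open>S\<close>, and it is not a scalar because
  \<open>\<sigma>\<close> and \<open>\<tau>\<close> are orthogonal. Any eigenspace of \<open>\<sigma> \<tau>\<close> is the desired invariant subspace.
\<close>

text \<open>The mixed-product rule: the summation index \<open>l\<close> corresponds to the pair
  \<open>l div m\<close>, \<open>l mod m\<close>, and the resulting double sum factors.\<close>

lemma kron_mult_kron:
  assumes A: "A \<in> carrier_mat k k" "A' \<in> carrier_mat k k"
    and B: "B \<in> carrier_mat m m" "B' \<in> carrier_mat m m" and m: "m > 0"
  shows "kron A B * kron A' B' = kron (A * A') (B * B')"
proof (rule eq_matI)
  show "dim_row (kron A B * kron A' B') = dim_row (kron (A * A') (B * B'))"
    "dim_col (kron A B * kron A' B') = dim_col (kron (A * A') (B * B'))"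
    using A B by (auto simp: kron_def)
next
  fix i j assume "i < dim_row (kron (A * A') (B * B'))" "j < dim_col (kron (A * A') (B * B'))"
  then have i: "i < k * m" and j: "j < k * m" using A B by (auto simp: kron_def)
  have ij: "i div m < k" "j div m < k" "i mod m < m" "j mod m < m"
    using i j m by (simp_all add: less_mult_imp_div_less)
  have "(kron A B * kron A' B') $$ (i, j) =
      (\<Sum>l<k * m. A $$ (i div m, l div m) * B $$ (i mod m, l mod m) *
                 (A' $$ (l div m, j div m) * B' $$ (l mod m, j mod m)))"
    using A B i j by (auto simp: kron_def scalar_prod_def atLeast0LessThan intro!: sum.cong)
  also have "\<dots> = (\<Sum>a<k. \<Sum>b<m. A $$ (i div m, a) * B $$ (i mod m, b) *
                 (A' $$ (a, j div m) * B' $$ (b, j mod m)))"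
    by (rule sum_div_mod[OF m])
  also have "\<dots> = (\<Sum>a<k. A $$ (i div m, a) * A' $$ (a, j div m)) *
                 (\<Sum>b<m. B $$ (i mod m, b) * B' $$ (b, j mod m))"
    by (simp add: sum_product mult_ac)
  also have "\<dots> = kron (A * A') (B * B') $$ (i, j)"
    using A B i j ij by (simp add: kron_def scalar_prod_def atLeast0LessThan)
  finally show "(kron A B * kron A' B') $$ (i, j) = kron (A * A') (B * B') $$ (i, j)" .
qed

lemma kron_smult: "kron (a \<cdot>\<^sub>m A) (b \<cdot>\<^sub>m B) = (a * b) \<cdot>\<^sub>m kron A B"
proof (rule eq_matI)
  fix i j
  assume "i < dim_row ((a * b) \<cdot>\<^sub>m kron A B)" "j < dim_col ((a * b) \<cdot>\<^sub>m kron A B)"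
  then have i: "i < dim_row A * dim_row B" and j: "j < dim_col A * dim_col B"
    by (auto simp: kron_def)
  \<comment> \<open>An index below a product forces the factors to be positive; this bounds the
    remainders \<open>i mod dim_row B\<close> and \<open>j mod dim_col B\<close>.\<close>
  then have "0 < dim_row B" "0 < dim_col B" by (auto intro: gr0I)
  with i j show "kron (a \<cdot>\<^sub>m A) (b \<cdot>\<^sub>m B) $$ (i, j) = ((a * b) \<cdot>\<^sub>m kron A B) $$ (i, j)"
    by (simp add: kron_def less_mult_imp_div_less)
qed (simp_all add: kron_def)

lemma kron_one: "m > 0 \<Longrightarrow> kron (1\<^sub>m k) (1\<^sub>m m) = 1\<^sub>m (k * m)"
  by (rule eq_matI) (auto simp: kron_def less_mult_imp_div_less, metis div_mult_mod_eq)

lemma pauli_square: "pauli j * pauli j = 1\<^sub>m 2"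
  by (rule eq_matI)
    (auto simp: pauli_def mat_of_rows_list_def scalar_prod_def numeral_2_eq_2 less_Suc_eq)

text \<open>No bound on the indices: \<open>pauli\<close> maps every index from 3 on to the same
  matrix. Hence the case split is on \<open>pauli j = pauli k\<close> and not on
  \<open>j = k\<close>.\<close>

lemma pauli_commute_or_anticommute:
  "\<exists>e \<in> {1, -1}. pauli j * pauli k = e \<cdot>\<^sub>m (pauli k * pauli j)"
proof -
  have "pauli j * pauli k = 1 \<cdot>\<^sub>m (pauli k * pauli j)" if "j = 0 \<or> k = 0 \<or> pauli j = pauli k"
    using that pauli_carrier[of j] pauli_carrier[of k] by (auto simp: pauli_def[of 0])
  moreover have "pauli j * pauli k = (-1) \<cdot>\<^sub>m (pauli k * pauli j)"
    if "\<not> (j = 0 \<or> k = 0 \<or> pauli j = pauli k)"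
    using that by (cases "j = 1"; cases "j = 2"; cases "k = 1"; cases "k = 2"; intro eq_matI)
      (auto simp: pauli_def mat_of_rows_list_def scalar_prod_def numeral_2_eq_2 less_Suc_eq)
  ultimately show ?thesis by blast
qed

text \<open>Makes each Pauli operator its own inverse, so that it can be cancelled from a
  product.\<close>

lemma pauli_tensor_square:
  "pauli_tensor js * pauli_tensor js = 1\<^sub>m (2 ^ length js)"
  by (induction js)
    (simp_all add: kron_mult_kron[OF pauli_carrier pauli_carrier pauli_tensor_carrier pauli_tensor_carrier]
      pauli_square kron_one)

text \<open>The signs of the tensor factors multiply, and \<open>{1, -1}\<close> is closed under
  products. Writing the sign as a scalar \<open>e\<close> lets the induction avoid a case analysis
  on pairs of signs.\<close>

lemma pauli_tensor_commute_or_anticommute: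
  assumes "length js = length ks"
  shows "\<exists>e \<in> {1, -1}. pauli_tensor js * pauli_tensor ks = e \<cdot>\<^sub>m (pauli_tensor ks * pauli_tensor js)"
  using assms
proof (induction js ks rule: list_induct2)
  case Nil
  then show ?case by (intro bexI[of _ 1]) auto
next
  case (Cons j js k ks)
  obtain e where e: "e \<in> {1, -1}" "pauli j * pauli k = e \<cdot>\<^sub>m (pauli k * pauli j)"
    using pauli_commute_or_anticommute by blast
  obtain d where d: "d \<in> {1, -1}"
    "pauli_tensor js * pauli_tensor ks = d \<cdot>\<^sub>m (pauli_tensor ks * pauli_tensor js)"
    using Cons.IH by blast
  have ks: "pauli_tensor ks \<in> carrier_mat (2 ^ length js) (2 ^ length js)"
    using pauli_tensor_carrier[of ks] Cons.hyps by simp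
  note mult = kron_mult_kron[OF pauli_carrier pauli_carrier]
  have "pauli_tensor (j # js) * pauli_tensor (k # ks) =
      (e * d) \<cdot>\<^sub>m (pauli_tensor (k # ks) * pauli_tensor (j # js))"
    by (simp add: mult[OF pauli_tensor_carrier ks] mult[OF ks pauli_tensor_carrier] e(2) d(2) kron_smult)
  moreover have "e * d \<in> {1, -1}" using e(1) d(1) by auto
  ultimately show ?case by blast
qed

lemma pauli_ops_commute_or_anticommute:
  assumes "\<sigma> \<in> pauli_ops n" "\<tau> \<in> pauli_ops n"
  shows "\<sigma> * \<tau> = \<tau> * \<sigma> \<or> \<sigma> * \<tau> = - (\<tau> * \<sigma>)"
proof -
  obtain js ks where "\<sigma> = pauli_tensor js" "\<tau> = pauli_tensor ks" "length js = length ks"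
    using assms unfolding pauli_ops_def mem_Collect_eq by metis
  then obtain e where e: "e \<in> {1, -1}" "\<sigma> * \<tau> = e \<cdot>\<^sub>m (\<tau> * \<sigma>)"
    using pauli_tensor_commute_or_anticommute by metis
  have "1 \<cdot>\<^sub>m (\<tau> * \<sigma>) = \<tau> * \<sigma>" "(-1) \<cdot>\<^sub>m (\<tau> * \<sigma>) = - (\<tau> * \<sigma>)"
    by (rule eq_matI; simp)+
  with e show ?thesis by auto
qed

text \<open>Serves twice: to pass from Pauli operators to each \<open>H k\<close>, and from the
  \<open>H k\<close> to the Hamiltonian.\<close>

lemma finsum_op_space_commute:
  assumes "finite X" "T \<in> carrier_mat (2 ^ n) (2 ^ n)"
    and "\<And>x. x \<in> X \<Longrightarrow> f x \<in> carrier_mat (2 ^ n) (2 ^ n)"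
    and "\<And>x. x \<in> X \<Longrightarrow> T * f x = f x * T"
  shows "T * finsum (op_space n) f X = finsum (op_space n) f X * T"
  using assms
proof (induction X rule: finite_induct)
  interpret abelian_group "op_space n" by (rule abelian_group_mat)
  case empty
  then show ?case by (simp add: module_mat_simps)
next
  interpret abelian_group "op_space n" by (rule abelian_group_mat)
  case (insert x X)
  have "finsum (op_space n) f (insert x X) = f x + finsum (op_space n) f X"
    using insert finsum_insert[of X x f] by (auto simp: module_mat_simps)
  moreover have "finsum (op_space n) f X \<in> carrier_mat (2 ^ n) (2 ^ n)"
    using insert finsum_op_space[of X f n] by auto
  ultimately show ?case
    using insert by (simp add: mult_add_distrib_mat[of _ "2 ^ n" "2 ^ n" _ "2 ^ n"]
        add_mult_distrib_mat[of _ "2 ^ n" "2 ^ n" _ _ "2 ^ n"])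
qed

text \<open>\<open>V\<close> is an eigenspace of \<open>T\<close>; an eigenvalue exists over the
  complex numbers because \<open>N > 0\<close>. It is proper since \<open>T\<close> is not scalar,
  and a matrix commuting with \<open>T\<close> preserves it. A single \<open>V\<close> works for the
  whole commutant.\<close>

lemma nonscalar_commutant_invariant_subspace:
  fixes T :: "complex mat"
  assumes T: "T \<in> carrier_mat N N" and N: "N > 0" and nonscalar: "\<And>c. T \<noteq> c \<cdot>\<^sub>m 1\<^sub>m N"
  shows "\<exists>V. VectorSpace.subspace class_ring V (module_vec TYPE(complex) N) \<and>
           V \<noteq> {0\<^sub>v N} \<and> V \<noteq> carrier_vec N \<and>
           (\<forall>A \<in> carrier_mat N N. T * A = A * T \<longrightarrow> (\<forall>v \<in> V. A *\<^sub>v v \<in> V))"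
proof -
  obtain e where "eigenvalue T e"
    using spectrum_non_empty[OF T] N by (auto simp: spectrum_def)
  then obtain w where w: "w \<in> carrier_vec N" "w \<noteq> 0\<^sub>v N" "T *\<^sub>v w = e \<cdot>\<^sub>v w"
    using T by (auto simp: eigenvalue_def eigenvector_def)
  define V where "V = {v \<in> carrier_vec N. T *\<^sub>v v = e \<cdot>\<^sub>v v}"
  interpret vec_space "TYPE(complex)" N .
  have "VectorSpace.subspace class_ring V (module_vec TYPE(complex) N)"
    unfolding VectorSpace.subspace_def submodule_def using T
    by (auto simp: V_def module_vec_simps class_ring_simps vec_vs vec_module
        mult_add_distrib_mat_vec smult_add_distrib_vec mult_mat_vec smult_smult_assoc mult.commute)
  moreover have "V \<noteq> {0\<^sub>v N}" using w by (auto simp: V_def)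
  moreover have "V \<noteq> carrier_vec N"
  proof
    assume "V = carrier_vec N"
    then have eig: "T *\<^sub>v v = e \<cdot>\<^sub>v v" if "v \<in> carrier_vec N" for v
      using that V_def by blast
    \<comment> \<open>If every vector satisfies the eigenvalue equation, the unit vectors do, and
      they yield the columns of \<open>T\<close>.\<close>
    have "T $$ (i, j) = (e \<cdot>\<^sub>v unit_vec N j) $ i" if "i < N" "j < N" for i j
    proof -
      have "T $$ (i, j) = (T *\<^sub>v unit_vec N j) $ i" using T that by simp
      then show ?thesis by (simp add: eig)
    qed
    then have "T = e \<cdot>\<^sub>m 1\<^sub>m N"
      using T by (intro eq_matI) auto
    with nonscalar show False by blast
  qed
  moreover have "A *\<^sub>v v \<in> V" if A: "A \<in> carrier_mat N N" "T * A = A * T" and v: "v \<in> V" for A v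
  proof -
    have "T *\<^sub>v (A *\<^sub>v v) = A *\<^sub>v (T *\<^sub>v v)"
      using T A v by (metis (no_types, lifting) V_def assoc_mult_mat_vec mem_Collect_eq)
    also have "\<dots> = e \<cdot>\<^sub>v (A *\<^sub>v v)" using A v by (auto simp: V_def mult_mat_vec)
    finally show ?thesis using A v by (auto simp: V_def)
  qed
  ultimately show ?thesis by blast
qed

theorem theorem5p4:
  fixes n M :: nat and H :: "nat \<Rightarrow> complex mat"
  assumes "n \<ge> 1"
    and "spin_hamiltonian_model n M H"
    and "card (appearing_paulis n M H) < 2 * n"
  shows "\<exists>V. VectorSpace.subspace class_ring V (module_vec TYPE(complex) (2 ^ n)) \<and>
           V \<noteq> {0\<^sub>v (2 ^ n)} \<and> V \<noteq> carrier_vec (2 ^ n) \<and>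
           (\<forall>l \<in> carrier_vec M. \<forall>v \<in> V. hamiltonian n M H l *\<^sub>v v \<in> V)"
proof -
  let ?N = "2 ^ n :: nat" and ?S = "appearing_paulis n M H"
  let ?C = "carrier_mat ?N ?N :: complex mat set"
  have S: "?S \<subseteq> pauli_ops n" by (auto simp: appearing_paulis_def pauli_ops_star_def)
  have carr: "\<sigma> \<in> ?C" if "\<sigma> \<in> pauli_ops n" for \<sigma> using that pauli_ops_carrier by auto
  have square: "\<sigma> * \<sigma> = 1\<^sub>m ?N" if "\<sigma> \<in> pauli_ops n" for \<sigma>
    using that pauli_tensor_square by (auto simp: pauli_ops_def)
  \<comment> \<open>This subset of \<open>?S\<close> encodes all commutation signs of
    \<open>\<sigma>\<close> with \<open>?S\<close>, because members of \<open>?S\<close> outside it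
    anticommute with \<open>\<sigma>\<close>.\<close>
  define centr where "centr \<sigma> = {s \<in> ?S. \<sigma> * s = s * \<sigma>}" for \<sigma>
  have "card (centr ` pauli_ops n) \<le> card (Pow ?S)"
    using finite_subset[OF S finite_pauli_ops] by (intro card_mono) (auto simp: centr_def)
  also have "\<dots> = 2 ^ card ?S" using finite_subset[OF S finite_pauli_ops] by (simp add: card_Pow)
  also have "\<dots> < 2 ^ (2 * n)" using assms(3) by simp
  also have "\<dots> = card (pauli_ops n)" by (simp add: card_pauli_ops power_mult)
  finally have "\<not> inj_on centr (pauli_ops n)" by (rule pigeonhole)
  then obtain \<sigma> \<tau> where \<sigma>\<tau>: "\<sigma> \<in> pauli_ops n" "\<tau> \<in> pauli_ops n" "\<sigma> \<noteq> \<tau>" "centr \<sigma> = centr \<tau>"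
    by (auto simp: inj_on_def)
  define T where "T = \<sigma> * \<tau>"
  have T: "T \<in> ?C" unfolding T_def using carr[OF \<sigma>\<tau>(1)] carr[OF \<sigma>\<tau>(2)] by (rule mult_carrier_mat)
  have "T \<noteq> c \<cdot>\<^sub>m 1\<^sub>m ?N" for c
  proof
    assume "T = c \<cdot>\<^sub>m 1\<^sub>m ?N"
    \<comment> \<open>Multiplying by \<open>\<tau>\<close>, which is its own inverse, isolates
      \<open>\<sigma>\<close>.\<close>
    then have "(\<sigma> * \<tau>) * \<tau> = c \<cdot>\<^sub>m \<tau>" using carr[OF \<sigma>\<tau>(2)]
      by (simp add: T_def mult_smult_assoc_mat[OF one_carrier_mat])
    then have "\<sigma> = c \<cdot>\<^sub>m \<tau>"
      using carr[OF \<sigma>\<tau>(1)] carr[OF \<sigma>\<tau>(2)] square[OF \<sigma>\<tau>(2)]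
      by (simp add: assoc_mult_mat[of _ ?N ?N _ ?N _ ?N])
    \<comment> \<open>By orthogonality the second equation has \<open>2 ^ n\<close> on the left and
      zero on the right.\<close>
    then have "hs_inner \<tau> \<sigma> = c * hs_inner \<tau> \<tau>" "hs_inner \<sigma> \<sigma> = c * hs_inner \<sigma> \<tau>"
      using carr[OF \<sigma>\<tau>(1)] carr[OF \<sigma>\<tau>(2)]
      by (auto simp: hs_inner_def sum_distrib_left mult_ac intro!: sum.cong)
    with \<sigma>\<tau> show False by (simp add: hs_inner_pauli_ops[of _ n])
  qed
  from nonscalar_commutant_invariant_subspace[OF T _ this] obtain V where
    V: "VectorSpace.subspace class_ring V (module_vec TYPE(complex) ?N)"
      "V \<noteq> {0\<^sub>v ?N}" "V \<noteq> carrier_vec ?N"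
      "\<And>A v. A \<in> ?C \<Longrightarrow> T * A = A * T \<Longrightarrow> v \<in> V \<Longrightarrow> A *\<^sub>v v \<in> V"
    by auto
  have TS: "T * s = s * T" if s: "s \<in> ?S" for s
  proof -
    have c: "\<sigma> \<in> ?C" "\<tau> \<in> ?C" "s \<in> ?C" using carr \<sigma>\<tau> s S by auto
    \<comment> \<open>Mixed signs are excluded by
      \<open>centr \<sigma> = centr \<tau>\<close>.\<close>
    consider "\<sigma> * s = s * \<sigma>" "\<tau> * s = s * \<tau>"
      | "\<sigma> * s = - (s * \<sigma>)" "\<tau> * s = - (s * \<tau>)"
      using pauli_ops_commute_or_anticommute[of \<sigma> n s] pauli_ops_commute_or_anticommute[of \<tau> n s] \<sigma>\<tau> s S unfolding centr_def by blast
    then show ?thesis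
    proof cases
      case 1
      have "T * s = \<sigma> * (\<tau> * s)" using c by (simp add: T_def assoc_mult_mat[of _ ?N ?N _ ?N _ ?N])
      also have "\<dots> = (\<sigma> * s) * \<tau>" using c by (simp add: 1(2) assoc_mult_mat[of _ ?N ?N _ ?N _ ?N])
      also have "\<dots> = s * T" unfolding 1(1) T_def using c by (simp add: assoc_mult_mat[of _ ?N ?N _ ?N _ ?N])
      finally show ?thesis .
    next
      case 2
      \<comment> \<open>Moving \<open>s\<close> past \<open>\<tau>\<close> and then past
        \<open>\<sigma>\<close> produces two signs, which cancel.\<close>
      have "T * s = \<sigma> * (\<tau> * s)" using c by (simp add: T_def assoc_mult_mat[of _ ?N ?N _ ?N _ ?N])
      also have "\<dots> = - ((\<sigma> * s) * \<tau>)" using c by (simp add: 2(2) assoc_mult_mat[of _ ?N ?N _ ?N _ ?N])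
      also have "\<dots> = s * T" unfolding 2(1) T_def using c by (simp add: assoc_mult_mat[of _ ?N ?N _ ?N _ ?N])
      finally show ?thesis .
    qed
  qed
  have HC: "H k \<in> ?C" if "k < M" for k
    using assms(2) that by (auto simp: spin_hamiltonian_model_def)
  have TH: "T * H k = H k * T" if k: "k < M" for k
  proof -
    obtain c where c: "pauli_expansion n (H k) c"
      using assms(2) k by (auto simp: spin_hamiltonian_model_def)
    have star: "pauli_ops_star n \<subseteq> pauli_ops n" by (auto simp: pauli_ops_star_def)
    have "T * (c s \<cdot>\<^sub>m s) = (c s \<cdot>\<^sub>m s) * T" if s: "s \<in> pauli_ops_star n" for s
    proof -
      have sC: "s \<in> ?C" using s star carr by auto
      \<comment> \<open>A Pauli operator outside \<open>?S\<close> may fail to commute with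
        \<open>T\<close>, but its coefficient vanishes: a non-zero \<open>c s\<close> would witness
        membership in \<open>?S\<close>.\<close>
      have "c s \<cdot>\<^sub>m (T * s) = c s \<cdot>\<^sub>m (s * T)"
      proof (cases "c s = 0")
        case True
        then show ?thesis using sC T by (intro eq_matI) auto
      next
        case False
        then have "s \<in> ?S" using c k s by (auto simp: appearing_paulis_def)
        then show ?thesis by (simp add: TS)
      qed
      then show ?thesis using sC T
        by (simp add: mult_smult_distrib[of _ ?N ?N _ ?N] mult_smult_assoc_mat[of _ ?N ?N _ ?N])
    qed
    then show ?thesis
      using c star carr finite_subset[OF star finite_pauli_ops] T unfolding pauli_expansion_def
      by (auto intro!: finsum_op_space_commute)
  qed
  have "hamiltonian n M H l \<in> ?C" for l
    unfolding hamiltonian_def using finsum_op_space[of "{..<M}"] HC by simp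
  \<comment> \<open>Neither \<open>T\<close> nor \<open>V\<close> depends on \<open>l\<close>, so
    one subspace serves all parameters.\<close>
  moreover have "T * hamiltonian n M H l = hamiltonian n M H l * T" for l
    unfolding hamiltonian_def
    using T HC TH by (intro finsum_op_space_commute)
      (simp_all add: mult_smult_distrib[of _ ?N ?N _ ?N] mult_smult_assoc_mat[of _ ?N ?N _ ?N])
  ultimately show ?thesis using V by blast
qed

end
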